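(* Let $\langle A\rangle$ and $\langle B\rangle$ be numerical semigroups minimally generated by $A=\{a_1,\dots,a_p\}$ and $B=\{b_1,\dots,b_q\}$ respectively, and let $\langle C\rangle$ be a gluing of $\langle A\rangle$ and $\langle B\rangle$, that is, $\langle C\rangle$ is a numerical semigroup whose set of minimal generators is a disjoint union $C=k_1A\sqcup k_2B$ with $k_1\in\langle B\rangle\setminus B$ and $k_2\in\langle A\rangle\setminus A$. If $\langle A\rangle$ and $\langle B\rangle$ satisfy the Wilf inequality, i.e. $p\,n_A\ge F_A+1$ and $q\,n_B\ge F_B+1$, then $\langle C\rangle$ satisfies the Wilf inequality, i.e. $(p+q)\,n_C\ge F_C+1$.
   Context: A numerical semigroup $\langle A\rangle$ is the submonoid of $\mathbb{N}=\{0,1,2,\dots\}$ generated by a finite set $A=\{a_1,\dots,a_p\}$ of positive integers with $\gcd(a_1,\dots,a_p)=1$; such a submonoid contains all but finitely many positive integers. It is minimally generated by $A$ if no proper subset of $A$ generates it (the minimal generating set is unique). The Frobenius number $F_A$ is the largest integer not in $\langle A\rangle$ (so $F_A=-1$ if $\langle A\rangle=\mathbb{N}$). The number $n_A$ is the number of elements of $\langle A\rangle$ that are less than $F_A$ (so $n_A=0$ if $\langle A\rangle=\mathbb{N}$). For an integer $k$ and $A=\{a_1,\dots,a_p\}$, $kA=\{ka_1,\dots,ka_p\}$. The notations $F_B,n_B,F_C,n_C$ are defined in the same way for $\langle B\rangle$ and $\langle C\rangle$. Since $\langle C\rangle$ is a numerical semigroup, $k_1$ and $k_2$ are necessarily relatively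 prime. The minimal generating set of $\langle C\rangle$ has $p+q$ elements. *)

theory Defs
  imports Main
begin

inductive_set generated_submonoid :: "nat set \<Rightarrow> nat set" for A :: "nat set" where
  zero: "0 \<in> generated_submonoid A"
| generator: "a \<in> A \<Longrightarrow> a \<in> generated_submonoid A"
| add: "x \<in> generated_submonoid A \<Longrightarrow> y \<in> generated_submonoid A \<Longrightarrow> x + y \<in> generated_submonoid A"

(* A is nonempty here, since Gcd {} = 0. *)
definition generates_numerical_semigroup :: "nat set \<Rightarrow> bool" where
  "generates_numerical_semigroup A \<longleftrightarrow> finite A \<and> (\<forall>a\<in>A. 0 < a) \<and> Gcd A = 1"

definition minimally_generates_numerical_semigroup :: "nat set \<Rightarrow> bool" where
  "minimally_generates_numerical_semigroup A \<longleftrightarrow>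
     generates_numerical_semigroup A \<and>
     (\<forall>A'. A' \<subset> A \<longrightarrow> generated_submonoid A' \<noteq> generated_submonoid A)"

(* The maximum is taken over all integers, not only the naturals, so the value is -1
   when A generates all of nat.  It is meaningful only if A generates a numerical semigroup. *)
definition frobenius_number :: "nat set \<Rightarrow> int" where
  "frobenius_number A = (GREATEST z::int. z \<notin> int ` generated_submonoid A)"

definition num_below_frobenius :: "nat set \<Rightarrow> nat" where
  "num_below_frobenius A = card {s \<in> generated_submonoid A. int s < frobenius_number A}"

(* Semigroups are represented by their (unique) minimal generating sets. *)
definition is_gluing :: "nat set \<Rightarrow> nat set \<Rightarrow> nat set \<Rightarrow> bool" where
  "is_gluing C A B \<longleftrightarrow>
     minimally_generates_numerical_semigroup C \<and>
     (\<exists>k1 k2. k1 \<in> generated_submonoid B - B \<and>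
              k2 \<in> generated_submonoid A - A \<and>
              C = (\<lambda>a. k1 * a) ` A \<union> (\<lambda>b. k2 * b) ` B \<and>
              (\<lambda>a. k1 * a) ` A \<inter> (\<lambda>b. k2 * b) ` B = {})"

end

theory Submission
  imports Defs
begin

text \<open>
  Write \<open>g\<close> for the number of gaps, so that \<open>n + g = F + 1\<close>.  If \<open>F\<^sub>A\<close> and \<open>F\<^sub>B\<close> are the
  Frobenius numbers, then \<open>k\<^sub>1 F\<^sub>A + k\<^sub>2 F\<^sub>B + k\<^sub>1 k\<^sub>2\<close> is not in \<open>\<langle>C\<rangle>\<close>, and every gap of \<open>\<langle>C\<rangle>\<close> is a gap
  of \<open>\<langle>k\<^sub>1, k\<^sub>2\<rangle>\<close>, or \<open>k\<^sub>1 x + k\<^sub>2 y\<close> with \<open>x\<close> a gap of \<open>\<langle>A\<rangle>\<close> and \<open>0 \<le> y < k\<^sub>1\<close>, or \<open>k\<^sub>1 w + k\<^sub>2 y\<close> with \<open>y\<close> a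
  gap of \<open>\<langle>B\<rangle>\<close> and \<open>w\<close> the least element of \<open>\<langle>A\<rangle>\<close> in one of the \<open>k\<^sub>2\<close> residue classes.  Hence
  \<open>F\<^sub>C + 1 \<ge> k\<^sub>1 (F\<^sub>A + 1) + k\<^sub>2 (F\<^sub>B + 1) + h\<close> and \<open>2 g\<^sub>C \<le> 2 k\<^sub>1 g\<^sub>A + 2 k\<^sub>2 g\<^sub>B + h\<close> with
  \<open>h = (k\<^sub>1 - 1) (k\<^sub>2 - 1)\<close>.  These two bounds suffice, because \<open>p + q \<ge> 2\<close> and the Wilf inequality
  for \<open>C\<close> reads \<open>(p + q - 1) (F\<^sub>C + 1) \<ge> (p + q) g\<^sub>C\<close>.
\<close>

section \<open>Numerical semigroups\<close>

abbreviation gaps :: "nat set \<Rightarrow> nat set" where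
  "gaps A \<equiv> - generated_submonoid A"

lemma generated_submonoid_mult:
  "x \<in> generated_submonoid A \<Longrightarrow> n * x \<in> generated_submonoid A"
  by (induction n) (auto intro: generated_submonoid.intros)

text \<open>Let \<open>d\<close> be the least positive difference of two elements. If
  \<open>d\<close> failed to divide a generator \<open>m\<close>, then \<open>m mod d\<close> would
  be a smaller positive difference; so \<open>d\<close> divides \<open>Gcd A = 1\<close>.\<close>

lemma exists_consecutive:
  assumes "Gcd A = 1"
  shows "\<exists>s. s \<in> generated_submonoid A \<and> Suc s \<in> generated_submonoid A"
proof -
  let ?M = "generated_submonoid A"
  let ?P = "\<lambda>d. 0 < d \<and> (\<exists>y\<in>?M. y + d \<in> ?M)"
  have "\<exists>a\<in>A. a \<noteq> 0"
    using assms by (metis Gcd_0_iff singletonI subset_iff zero_neq_one)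
  then obtain a where "a \<in> A" "0 < a" by auto
  then have "?P a"
    by (auto intro!: bexI[of _ 0] generated_submonoid.zero generated_submonoid.generator)
  define d where "d = (LEAST d. ?P d)"
  have d: "?P d" unfolding d_def by (rule LeastI[of ?P, OF \<open>?P a\<close>])
  have least: "d \<le> r" if "?P r" for r
    unfolding d_def by (rule Least_le[of ?P, OF that])
  obtain y where y: "y \<in> ?M" "y + d \<in> ?M" using d by auto
  have "d dvd m" if "m \<in> A" for m
  proof (rule ccontr)
    assume nd: "\<not> d dvd m"
    let ?q = "m div d" and ?r = "m mod d"
    \<comment> \<open>Both \<open>?q * (y + d)\<close> and \<open>m + ?q * y\<close> lie in the
      submonoid, and they differ by \<open>?r\<close>.\<close>
    have "?q * (y + d) + ?r = m + ?q * y"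
      by (simp add: algebra_simps)
    moreover have "m + ?q * y \<in> ?M"
      by (intro generated_submonoid.add generated_submonoid.generator that
          generated_submonoid_mult y)
    moreover have "?q * (y + d) \<in> ?M" by (intro generated_submonoid_mult y)
    moreover have "0 < ?r" using nd by (simp add: dvd_eq_mod_eq_0)
    ultimately have "?P ?r" by metis
    with least have "d \<le> ?r" by blast
    moreover have "?r < d" using d by simp
    ultimately show False by simp
  qed
  then have "d dvd Gcd A" by (rule Gcd_greatest)
  then have "d = 1" using assms by simp
  then show ?thesis using y by auto
qed

text \<open>Beyond \<open>s * s\<close> the quotient by \<open>s\<close> exceeds the remainder, so
  the remainder can be absorbed by trading copies of \<open>s\<close> for copies of
  \<open>Suc s\<close>.\<close>

lemma finite_gaps:
  assumes "Gcd A = 1"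
  shows "finite (gaps A)"
proof -
  obtain s where s: "s \<in> generated_submonoid A" "Suc s \<in> generated_submonoid A"
    using exists_consecutive[OF assms] by blast
  have "n \<in> generated_submonoid A" if n: "n \<ge> s * s" for n
  proof (cases "s = 0")
    case True
    then show ?thesis using generated_submonoid_mult[OF s(2), of n] by simp
  next
    case False
    let ?q = "n div s" and ?r = "n mod s"
    have "s \<le> ?q" using n False by (simp add: less_eq_div_iff_mult_less_eq)
    moreover have "?r < s" using False by simp
    ultimately have "?r \<le> ?q" by simp
    then have "(?q - ?r) * s + ?r * Suc s = ?q * s + ?r"
      by (simp add: diff_mult_distrib)
    then have "(?q - ?r) * s + ?r * Suc s = n" by simp
    then show ?thesis
      using generated_submonoid.add[OF generated_submonoid_mult[OF s(1)]
          generated_submonoid_mult[OF s(2)]] by metis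
  qed
  then have "gaps A \<subseteq> {..<s * s}" by (auto simp: not_le[symmetric])
  then show ?thesis using finite_subset by blast
qed

lemma
  assumes "Gcd A = 1"
  shows frobenius_number_notin: "frobenius_number A \<notin> int ` generated_submonoid A"
    and frobenius_number_ge: "z \<notin> int ` generated_submonoid A \<Longrightarrow> z \<le> frobenius_number A"
proof -
  let ?P = "\<lambda>z::int. z \<notin> int ` generated_submonoid A"
  \<comment> \<open>The inserted -1 keeps the maximum defined when there are no gaps, and is then
    the correct value.\<close>
  define F where "F = Max (insert (-1) (int ` gaps A))"
  have fin: "finite (insert (-1) (int ` gaps A))"
    using finite_gaps[OF assms] by simp
  have "F \<in> insert (-1) (int ` gaps A)" unfolding F_def by (rule Max_in[OF fin]) simp
  then have 1: "?P F" by auto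
  have 2: "z \<le> F" if "?P z" for z
  proof (cases "z < 0")
    case True
    have "-1 \<le> F" unfolding F_def by (rule Max_ge[OF fin]) simp
    then show ?thesis using True by simp
  next
    case False
    then have "z = int (nat z)" by simp
    then have "z \<in> int ` gaps A" using that by (metis ComplI image_eqI)
    then show ?thesis unfolding F_def by (intro Max_ge[OF fin]) simp
  qed
  have "frobenius_number A = F"
    unfolding frobenius_number_def by (rule Greatest_equality) (use 1 2 in auto)
  with 1 2 show "?P (frobenius_number A)" "?P z \<Longrightarrow> z \<le> frobenius_number A" by auto
qed

lemma num_below_frobenius_add_card_gaps:
  assumes "Gcd A = 1"
  shows "int (num_below_frobenius A) + int (card (gaps A)) = frobenius_number A + 1"
proof -
  let ?F = "frobenius_number A"
  let ?L = "{s \<in> generated_submonoid A. int s < ?F}"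
  have "-1 \<le> ?F" by (rule frobenius_number_ge[OF assms]) auto
  have le: "int x \<le> ?F" if "x \<in> gaps A" for x
    by (rule frobenius_number_ge[OF assms]) (use that in auto)
  have ne: "int x \<noteq> ?F" if "x \<in> generated_submonoid A" for x
    using frobenius_number_notin[OF assms] that by (metis image_eqI)
  have "?L \<union> gaps A = {..<nat (?F + 1)}"
  proof (rule set_eqI)
    fix x show "x \<in> ?L \<union> gaps A \<longleftrightarrow> x \<in> {..<nat (?F + 1)}"
      using le[of x] ne[of x] by (cases "x \<in> generated_submonoid A") auto
  qed
  moreover from this have "card (?L \<union> gaps A) = card ?L + card (gaps A)"
    by (intro card_Un_disjoint) (auto intro: finite_subset[of _ "{..<nat (?F + 1)}"])
  ultimately show ?thesis
    using \<open>-1 \<le> ?F\<close> unfolding num_below_frobenius_def by simp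
qed

section \<open>Semigroups with two generators\<close>

text \<open>Start from a Bezout combination and reduce the coefficient of \<open>l\<close> modulo
  \<open>k\<close>, moving the quotient into \<open>x\<close>.\<close>

lemma coprime_combination:
  fixes k l n :: int
  assumes "coprime k l" "0 < k"
  obtains x y where "n = k * x + l * y" "0 \<le> y" "y < k"
proof -
  obtain u v where uv: "u * k + v * l = 1"
    using bezout_int[of k l] assms by auto
  define y where "y = (n * v) mod k"
  define t where "t = (n * v) div k"
  have "n * v = k * t + y" unfolding y_def t_def by simp
  moreover have "n = k * (n * u) + l * (n * v)"
    using arg_cong[OF uv, of "(*) n"] by (simp add: algebra_simps)
  ultimately have "n = k * (n * u + l * t) + l * y"
    by (simp add: algebra_simps)
  moreover have "0 \<le> y" "y < k" using assms by (auto simp: y_def)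
  ultimately show ?thesis using that by blast
qed

text \<open>For a gap \<open>n\<close> the reflection \<open>k l - k - l - n\<close> is a nonnegative combination.\<close>

lemma two_generator_gaps:
  fixes k l :: nat
  assumes "coprime k l" "0 < k" "0 < l"
  defines "S \<equiv> {n. \<forall>x y. n \<noteq> k * x + l * y}"
  shows "finite S" "2 * card S \<le> (k - 1) * (l - 1)"
proof -
  define h where "h = (k - 1) * (l - 1)"
  have int_h: "int h = int k * int l - int k - int l + 1"
    unfolding h_def using assms(2,3) by (cases k; cases l) (simp_all add: algebra_simps)
  have refl: "\<exists>x y. n + (k * x + l * y) + 1 = h" if n: "n \<in> S" for n
  proof -
    obtain x y where xy: "int n = int k * x + int l * y" "0 \<le> y" "y < int k"
      using coprime_combination[of "int k" "int l" "int n"] assms by auto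
    have "x < 0"
    proof (rule ccontr)
      assume "\<not> x < 0"
      then have "int n = int (k * nat x + l * nat y)" using xy by simp
      then show False using n unfolding S_def of_nat_eq_iff by blast
    qed
    \<comment> \<open>Since \<open>x < 0\<close> and \<open>y < int k\<close>, both coefficients -1
      - x and k - 1 - y of the reflected number are nonnegative.\<close>
    then have "int (n + (k * nat (-1 - x) + l * nat (int k - 1 - y)) + 1) = int h"
      using xy by (simp add: int_h algebra_simps)
    then show ?thesis unfolding of_nat_eq_iff by blast
  qed
  have sub: "S \<subseteq> {..<h}" using refl by fastforce
  then show "finite S" using finite_subset by blast
  let ?f = "\<lambda>n. h - 1 - n"
  have inj: "inj_on ?f S"
  proof (rule inj_onI)
    fix x y assume "x \<in> S" "y \<in> S" "?f x = ?f y"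
    moreover from this have "x < h" "y < h" using sub by auto
    ultimately show "x = y" by simp
  qed
  \<comment> \<open>\<open>S\<close> and its mirror image are disjoint, equinumerous subsets of
    \<open>{..<h}\<close>, so \<open>S\<close> fills at most half of it.\<close>
  have "S \<inter> ?f ` S = {}"
  proof (rule ccontr)
    assume "S \<inter> ?f ` S \<noteq> {}"
    then obtain n where n: "n \<in> S" "h - 1 - n \<in> S" by blast
    obtain x y where "n + (k * x + l * y) + 1 = h" using refl[OF n(1)] by blast
    then have "h - 1 - n = k * x + l * y" by simp
    then show False using n(2) unfolding S_def by blast
  qed
  then have "card (S \<union> ?f ` S) = 2 * card S"
    using \<open>finite S\<close> inj by (simp add: card_Un_disjoint card_image)
  moreover have "S \<union> ?f ` S \<subseteq> {..<h}" using sub by fastforce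
  then have "card (S \<union> ?f ` S) \<le> h" using card_mono[of "{..<h}"] by fastforce
  ultimately show "2 * card S \<le> (k - 1) * (l - 1)" unfolding h_def by simp
qed

section \<open>Gluings\<close>

lemma generated_submonoid_scaled_union:
  "generated_submonoid ((\<lambda>a. k * a) ` A \<union> (\<lambda>b. l * b) ` B) =
     {k * a + l * b | a b. a \<in> generated_submonoid A \<and> b \<in> generated_submonoid B}"
  (is "generated_submonoid ?C = ?S")
proof
  show "generated_submonoid ?C \<subseteq> ?S"
  proof
    fix x assume "x \<in> generated_submonoid ?C"
    then show "x \<in> ?S"
    proof induction
      case zero
      show ?case using generated_submonoid.zero by force
    next
      case (generator c)
      then consider a where "a \<in> A" "c = k * a + l * 0" | b where "b \<in> B" "c = k * 0 + l * b"
        by auto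
      then show ?case
        by cases (blast intro: generated_submonoid.zero generated_submonoid.generator)+
    next
      case (add x y)
      then obtain a b a' b' where
        "a \<in> generated_submonoid A" "b \<in> generated_submonoid B" "x = k * a + l * b"
        "a' \<in> generated_submonoid A" "b' \<in> generated_submonoid B" "y = k * a' + l * b'" by blast
      moreover from this have "x + y = k * (a + a') + l * (b + b')"
        by (simp add: algebra_simps)
      ultimately show ?case using generated_submonoid.add by blast
    qed
  qed
  have "k * a \<in> generated_submonoid ?C" if "a \<in> generated_submonoid A" for a
    using that by induction (auto simp: distrib_left intro: generated_submonoid.intros)
  moreover have "l * b \<in> generated_submonoid ?C" if "b \<in> generated_submonoid B" for b
    using that by induction (auto simp: distrib_left intro: generated_submonoid.intros)
  ultimately show "?S \<subseteq> generated_submonoid ?C" by (auto intro: generated_submonoid.add)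
qed

locale gluing =
  fixes A B C :: "nat set" and k l :: nat
  assumes Gcd_A: "Gcd A = 1" and Gcd_B: "Gcd B = 1"
    and k: "k \<in> generated_submonoid B" and l: "l \<in> generated_submonoid A"
    and k_pos: "0 < k" and l_pos: "0 < l" and coprime: "coprime k l"
    and C: "C = (\<lambda>a. k * a) ` A \<union> (\<lambda>b. l * b) ` B"
begin

lemma Gcd_C: "Gcd C = 1"
proof -
  have "Gcd C dvd k * a" if "a \<in> A" for a
    by (rule Gcd_dvd) (use that C in blast)
  then have "Gcd C dvd Gcd ((*) k ` A)" by (auto intro: Gcd_greatest)
  moreover have "Gcd C dvd l * b" if "b \<in> B" for b
    by (rule Gcd_dvd) (use that C in blast)
  then have "Gcd C dvd Gcd ((*) l ` B)" by (auto intro: Gcd_greatest)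
  ultimately have "Gcd C dvd k" "Gcd C dvd l"
    using Gcd_A Gcd_B by (simp_all add: Gcd_mult)
  then show ?thesis using coprime by (metis coprime_common_divisor_nat)
qed

text \<open>If the left side were k a + l b in the glued semigroup, coprimality would give F_A = a +
  l j and F_B = b + k (-1 - j). One of j and -1 - j is nonnegative, which puts F_A into the first
  semigroup or F_B into the second.\<close>

lemma frobenius_number_gluing_ge:
  "int k * frobenius_number A + int l * frobenius_number B + int k * int l \<le> frobenius_number C"
proof (rule frobenius_number_ge[OF Gcd_C], rule notI)
  let ?FA = "frobenius_number A" and ?FB = "frobenius_number B"
  assume "int k * ?FA + int l * ?FB + int k * int l \<in> int ` generated_submonoid C"
  then obtain a b where a: "a \<in> generated_submonoid A" and b: "b \<in> generated_submonoid B"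
    and eq: "int k * ?FA + int l * ?FB + int k * int l = int k * int a + int l * int b"
    unfolding C generated_submonoid_scaled_union by auto
  have "int k * (?FA - int a) = int l * (int b - ?FB - int k)"
    using eq by (simp add: algebra_simps)
  then have "int l dvd int k * (?FA - int a)" by simp
  moreover have "coprime (int l) (int k)" using coprime by (simp add: coprime_commute)
  ultimately have "int l dvd ?FA - int a" by (simp add: coprime_dvd_mult_right_iff)
  then obtain j where j: "?FA - int a = int l * j" by (elim dvdE)
  have "int l * (int k * j) = int l * (int b - ?FB - int k)"
    using eq j by (simp add: algebra_simps)
  then have "int k * j = int b - ?FB - int k" using l_pos by (simp only: mult_cancel_left) simp
  then have j': "?FB = int b + int k * (-1 - j)" by (simp add: algebra_simps)
  show False
  proof (cases "0 \<le> j")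
    case True
    then have "?FA = int (a + nat j * l)" using j by (simp add: algebra_simps)
    moreover have "a + nat j * l \<in> generated_submonoid A"
      by (intro generated_submonoid.add generated_submonoid_mult a l)
    ultimately show False using frobenius_number_notin[OF Gcd_A] by (metis image_eqI)
  next
    case False
    then have "?FB = int (b + nat (-1 - j) * k)" using j' by (simp add: algebra_simps)
    moreover have "b + nat (-1 - j) * k \<in> generated_submonoid B"
      by (intro generated_submonoid.add generated_submonoid_mult b k)
    ultimately show False using frobenius_number_notin[OF Gcd_B] by (metis image_eqI)
  qed
qed

text \<open>The values of \<open>w\<close> on residues that occur form the Apery set with respect to
  \<open>l\<close>.\<close>

lemma gaps_gluing_subset:
  defines "w \<equiv> \<lambda>r. LEAST m. m \<in> generated_submonoid A \<and> m mod l = r"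
  shows "gaps C \<subseteq> {n. \<forall>x y. n \<noteq> k * x + l * y}
           \<union> (\<lambda>(y, x). k * x + l * y) ` ({..<k} \<times> gaps A)
           \<union> (\<lambda>(r, y). k * w r + l * y) ` ({..<l} \<times> gaps B)" (is "_ \<subseteq> ?S \<union> ?G \<union> ?H")
proof
  fix n assume n: "n \<in> gaps C"
  show "n \<in> ?S \<union> ?G \<union> ?H"
  proof (cases "n \<in> ?S")
    case False
    then obtain x0 y0 where n0: "n = k * x0 + l * y0" by blast
    define x where "x = x0 + l * (y0 div k)"
    define y where "y = y0 mod k"
    have "y0 = k * (y0 div k) + y" unfolding y_def by simp
    then have "l * y0 = k * (l * (y0 div k)) + l * y"
      by (metis distrib_left mult.left_commute)
    then have nxy: "n = k * x + l * y" using n0 unfolding x_def by (simp add: distrib_left)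
    have "y < k" using k_pos unfolding y_def by simp
    show ?thesis
    proof (cases "x \<in> generated_submonoid A")
      case False
      then have "n \<in> ?G" using nxy \<open>y < k\<close> by force
      then show ?thesis by blast
    next
      case True
      \<comment> \<open>With \<open>x\<close> in the semigroup of \<open>A\<close>, its excess over
        the Apery element is a multiple of \<open>l\<close> and can be shifted to the other
        coefficient, which must then be a gap of \<open>B\<close> because \<open>n\<close> is a gap
        of \<open>C\<close>.\<close>
      let ?P = "\<lambda>m. m \<in> generated_submonoid A \<and> m mod l = x mod l"
      have "?P x" using True by simp
      then have w: "?P (w (x mod l))" and le: "w (x mod l) \<le> x"
        unfolding w_def by (rule LeastI, rule Least_le)
      then have "l dvd x - w (x mod l)" using mod_eq_dvd_iff_nat[OF le, of l] by simp
      then obtain t where "x - w (x mod l) = l * t" by (elim dvdE)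
      then have "x = w (x mod l) + l * t" using le by linarith
      then have "k * x = k * w (x mod l) + l * (k * t)"
        by (metis distrib_left mult.left_commute)
      then have nw: "n = k * w (x mod l) + l * (y + k * t)"
        using nxy by (simp add: algebra_simps)
      then have "y + k * t \<in> gaps B"
        using n w unfolding C generated_submonoid_scaled_union by blast
      moreover have "x mod l < l" using l_pos by simp
      ultimately have "n \<in> ?H" using nw by force
      then show ?thesis by blast
    qed
  qed simp
qed

lemma card_gaps_gluing_le:
  "2 * card (gaps C) \<le> 2 * k * card (gaps A) + 2 * l * card (gaps B) + (k - 1) * (l - 1)"
proof -
  define w where "w = (\<lambda>r. LEAST m. m \<in> generated_submonoid A \<and> m mod l = r)"
  define S where "S = {n. \<forall>x y. n \<noteq> k * x + l * y}"
  define G where "G = (\<lambda>(y, x). k * x + l * y) ` ({..<k} \<times> gaps A)"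
  define H where "H = (\<lambda>(r, y). k * w r + l * y) ` ({..<l} \<times> gaps B)"
  note finite = finite_gaps[OF Gcd_A] finite_gaps[OF Gcd_B]
  have S: "finite S" "2 * card S \<le> (k - 1) * (l - 1)"
    unfolding S_def using two_generator_gaps[OF coprime k_pos l_pos] .
  have G: "finite G" "card G \<le> k * card (gaps A)"
    using finite card_image_le[of "{..<k} \<times> gaps A" "\<lambda>(y, x). k * x + l * y"]
    unfolding G_def by (simp_all add: card_cartesian_product)
  have H: "finite H" "card H \<le> l * card (gaps B)"
    using finite card_image_le[of "{..<l} \<times> gaps B" "\<lambda>(r, y). k * w r + l * y"]
    unfolding H_def by (simp_all add: card_cartesian_product)
  have "gaps C \<subseteq> S \<union> G \<union> H"
    unfolding S_def G_def H_def w_def by (rule gaps_gluing_subset)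
  then have "card (gaps C) \<le> card (S \<union> G \<union> H)"
    using S G H by (intro card_mono) auto
  also have "\<dots> \<le> card S + card G + card H"
    using card_Un_le[of "S \<union> G" H] card_Un_le[of S G] by linarith
  finally show ?thesis using S G H by (simp add: mult.assoc)
qed

text \<open>This is the gap bound rewritten by g = F + 1 - n. The last bracket is the slack in
  \<open>frobenius_number_gluing_ge\<close>.\<close>

lemma num_below_frobenius_gluing_ge:
  "2 * (int k * int (num_below_frobenius A) + int l * int (num_below_frobenius B))
     + (int k - 1) * (int l - 1)
     + 2 * (frobenius_number C + 1 - (int k * (frobenius_number A + 1)
         + int l * (frobenius_number B + 1) + (int k - 1) * (int l - 1)))
   \<le> 2 * int (num_below_frobenius C)"
proof -
  have "int (2 * card (gaps C))
      \<le> int (2 * k * card (gaps A) + 2 * l * card (gaps B) + (k - 1) * (l - 1))"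
    using card_gaps_gluing_le by (simp only: of_nat_le_iff)
  then have "2 * int (card (gaps C)) \<le> 2 * (int k * int (card (gaps A)))
      + 2 * (int l * int (card (gaps B))) + (int k - 1) * (int l - 1)"
    using k_pos l_pos by (simp add: of_nat_diff)
  moreover have "int (card (gaps A)) = frobenius_number A + 1 - int (num_below_frobenius A)"
    "int (card (gaps B)) = frobenius_number B + 1 - int (num_below_frobenius B)"
    "int (card (gaps C)) = frobenius_number C + 1 - int (num_below_frobenius C)"
    using num_below_frobenius_add_card_gaps[OF Gcd_A] num_below_frobenius_add_card_gaps[OF Gcd_B]
      num_below_frobenius_add_card_gaps[OF Gcd_C] by linarith+
  ultimately show ?thesis by (simp add: algebra_simps)
qed

lemma wilf_gluing:
  fixes p q :: int
  assumes "1 \<le> p" "1 \<le> q"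
    and A: "frobenius_number A + 1 \<le> p * int (num_below_frobenius A)"
    and B: "frobenius_number B + 1 \<le> q * int (num_below_frobenius B)"
  shows "frobenius_number C + 1 \<le> (p + q) * int (num_below_frobenius C)"
proof -
  define h where "h = (int k - 1) * (int l - 1)"
  define a where "a = int k * int (num_below_frobenius A)"
  define b where "b = int l * int (num_below_frobenius B)"
  define x where "x = int k * (frobenius_number A + 1)"
  define y where "y = int l * (frobenius_number B + 1)"
  define e where "e = frobenius_number C + 1 - (x + y + h)"
  have "0 \<le> h" using k_pos l_pos unfolding h_def by simp
  have "0 \<le> e"
    using frobenius_number_gluing_ge unfolding e_def h_def x_def y_def by (simp add: algebra_simps)
  have "0 \<le> a" "0 \<le> b" unfolding a_def b_def by simp_all
  have "x \<le> p * a"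
    using mult_left_mono[OF A, of "int k"] unfolding a_def x_def by (simp add: mult.left_commute)
  moreover have "y \<le> q * b"
    using mult_left_mono[OF B, of "int l"] unfolding b_def y_def by (simp add: mult.left_commute)
  moreover have "frobenius_number C + 1 = x + y + h + e" unfolding e_def by simp
  ultimately have "2 * (frobenius_number C + 1) \<le> 2 * (p * a) + 2 * (q * b) + 2 * (h + 2 * e)"
    using \<open>0 \<le> e\<close> by (simp add: algebra_simps)
  \<comment> \<open>Here p + q >= 2 is used: the terms not controlled by the two Wilf inequalities
    are absorbed.\<close>
  also have "2 * (h + 2 * e) \<le> (p + q) * (h + 2 * e)"
    using assms \<open>0 \<le> h\<close> \<open>0 \<le> e\<close> by (intro mult_right_mono) auto
  also have "2 * (p * a) + 2 * (q * b) \<le> (p + q) * (2 * (a + b))"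
    using assms \<open>0 \<le> a\<close> \<open>0 \<le> b\<close> by (simp add: algebra_simps)
  also have "(p + q) * (2 * (a + b)) + (p + q) * (h + 2 * e) = (p + q) * (2 * (a + b) + h + 2 * e)"
    by (simp add: algebra_simps)
  also have "\<dots> \<le> (p + q) * (2 * int (num_below_frobenius C))"
    using num_below_frobenius_gluing_ge assms unfolding a_def b_def e_def h_def x_def y_def
    by (intro mult_left_mono) auto
  finally show ?thesis by (simp add: mult.left_commute)
qed

end

theorem theorem2p3:
  fixes A B C :: "nat set" and p q :: nat
  assumes "minimally_generates_numerical_semigroup A" and "card A = p"
    and "minimally_generates_numerical_semigroup B" and "card B = q"
    and "is_gluing C A B"
    and "int p * int (num_below_frobenius A) \<ge> frobenius_number A + 1"
    and "int q * int (num_below_frobenius B) \<ge> frobenius_number B + 1"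
  shows "(int p + int q) * int (num_below_frobenius C) \<ge> frobenius_number C + 1"
proof -
  obtain k l where k: "k \<in> generated_submonoid B" and l: "l \<in> generated_submonoid A"
    and C: "C = (\<lambda>a. k * a) ` A \<union> (\<lambda>b. l * b) ` B"
    using assms(5) unfolding is_gluing_def by blast
  have A: "finite A" "Gcd A = 1" and B: "finite B" "Gcd B = 1"
    and "Gcd C = 1" and C_pos: "\<forall>c\<in>C. 0 < c"
    using assms(1,3,5)
    unfolding is_gluing_def minimally_generates_numerical_semigroup_def
      generates_numerical_semigroup_def by blast+
  have "A \<noteq> {}" "B \<noteq> {}" using A B by auto
  \<comment> \<open>A zero factor would put 0 among the generators of \<open>C\<close>.\<close>
  then have "0 < k" "0 < l" using C_pos C by auto
  have "gcd k l dvd c" if "c \<in> C" for c using that C by auto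
  then have "gcd k l dvd Gcd C" by (rule Gcd_greatest)
  then have "coprime k l" using \<open>Gcd C = 1\<close> by (simp add: coprime_iff_gcd_eq_1)
  then interpret gluing A B C k l
    by unfold_locales (use A B k l \<open>0 < k\<close> \<open>0 < l\<close> C in auto)
  have "1 \<le> p" "1 \<le> q"
    using A B \<open>A \<noteq> {}\<close> \<open>B \<noteq> {}\<close> assms(2,4) by (auto simp: Suc_le_eq card_gt_0_iff)
  then show ?thesis using wilf_gluing[of "int p" "int q"] assms(6,7) by simp
qed

end
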